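(* Let $(G,* )$ be a groupoid and let $A,B:G\to\mathbb{R}$ be functions. Assume that there exist $f,g:G\to\mathbb{R}$ such that $$A(x*y)=f(x)f(y)+g(x)g(y)\qquad\text{and}\qquad B(x*y)=f(x)g(y)+g(x)f(y)$$ for all $x,y\in G$. Then the inequalities $$B(x*x)\,B(y*y)\leq A(x*y)^2\leq A(x*x)\,A(y*y)$$ and $$B(x*x)\,B(y*y)\leq B(x*y)^2\leq A(x*x)\,A(y*y)$$ hold for all $x,y\in G$.
   Context: A groupoid $(G,* )$ is a set $G$ together with a binary operation $*:G\times G\to G$ (a magma); no associativity, commutativity or other property is assumed. $A(u)^2$ denotes $(A(u))^2$, and similarly for $B$. *)

theory Defs
  imports Complex_Main
begin

definition groupoid :: "'a set \<Rightarrow> ('a \<Rightarrow> 'a \<Rightarrow> 'a) \<Rightarrow> bool" where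
  "groupoid G star \<longleftrightarrow> (\<forall>x\<in>G. \<forall>y\<in>G. star x y \<in> G)"

end

theory Submission imports Defs begin

text \<open>
  Fix \<open>x\<close> and \<open>y\<close> and put \<open>(a, b) = (f x, g x)\<close> and \<open>(c, d) = (f y, g y)\<close>. The hypothesis turns
  the values of \<open>A\<close> and \<open>B\<close> at \<open>x \<star> x\<close>, \<open>y \<star> y\<close> and \<open>x \<star> y\<close> into polynomials in
  \<open>a, b, c, d\<close>, and in each of the four inequalities the larger side exceeds the smaller one by \<open>(a * c - b * d)\<^sup>2\<close> or by
  \<open>(a * d - b * c)\<^sup>2\<close>. The upper bounds are the two forms of the two-squares identity of
  Brahmagupta and Fibonacci, that is, the Cauchy--Schwarz inequality for \<open>(a, b)\<close> with \<open>(c, d)\<close>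
  and with \<open>(d, c)\<close>. The lower bounds are the inequality \<open>4 * u * v \<le> (u + v)\<^sup>2\<close>: the product
  \<open>B (x \<star> x) * B (y \<star> y) = 4 * a * b * c * d\<close> is \<open>4 * u * v\<close> both for
  \<open>(u, v) = (a * c, b * d)\<close> and for \<open>(u, v) = (a * d, b * c)\<close>.
\<close>

lemma four_mult_le_power2_sum:
  fixes u v :: real
  shows "4 * (u * v) \<le> (u + v)\<^sup>2"
proof -
  have "(u + v)\<^sup>2 - 4 * (u * v) = (u - v)\<^sup>2"
    by (simp add: power2_eq_square algebra_simps)
  then show ?thesis
    using zero_le_power2[of "u - v"] by linarith
qed

lemma cauchy_schwarz_two_squares:
  fixes a b c d :: real
  shows "(a * c + b * d)\<^sup>2 \<le> (a * a + b * b) * (c * c + d * d)"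
proof -
  have "(a * a + b * b) * (c * c + d * d) - (a * c + b * d)\<^sup>2 = (a * d - b * c)\<^sup>2"
    by (simp add: power2_eq_square algebra_simps)
  then show ?thesis
    using zero_le_power2[of "a * d - b * c"] by linarith
qed

theorem theorem4p5:
  fixes G :: "'a set"
    and star :: "'a \<Rightarrow> 'a \<Rightarrow> 'a" (infixl "\<star>" 70)
    and A B :: "'a \<Rightarrow> real"
  assumes "groupoid G (\<star>)"
    and "\<exists>f g :: 'a \<Rightarrow> real. \<forall>x\<in>G. \<forall>y\<in>G.
           A (x \<star> y) = f x * f y + g x * g y \<and>
           B (x \<star> y) = f x * g y + g x * f y"
  shows "\<forall>x\<in>G. \<forall>y\<in>G.
           (B (x \<star> x) * B (y \<star> y) \<le> (A (x \<star> y))\<^sup>2 \<and>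
            (A (x \<star> y))\<^sup>2 \<le> A (x \<star> x) * A (y \<star> y)) \<and>
           (B (x \<star> x) * B (y \<star> y) \<le> (B (x \<star> y))\<^sup>2 \<and>
            (B (x \<star> y))\<^sup>2 \<le> A (x \<star> x) * A (y \<star> y))"
proof (intro ballI)
  fix x y
  assume xy: "x \<in> G" "y \<in> G"
  obtain f g :: "'a \<Rightarrow> real" where
    A: "\<And>u v. u \<in> G \<Longrightarrow> v \<in> G \<Longrightarrow> A (u \<star> v) = f u * f v + g u * g v" and
    B: "\<And>u v. u \<in> G \<Longrightarrow> v \<in> G \<Longrightarrow> B (u \<star> v) = f u * g v + g u * f v"
    using assms(2) by blast
  have BB_A: "B (x \<star> x) * B (y \<star> y) = 4 * ((f x * f y) * (g x * g y))"
    using xy by (simp add: B algebra_simps)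
  have BB_B: "B (x \<star> x) * B (y \<star> y) = 4 * ((f x * g y) * (g x * f y))"
    using xy by (simp add: B algebra_simps)
  have AA: "A (x \<star> x) * A (y \<star> y) = (f x * f x + g x * g x) * (f y * f y + g y * g y)"
    using xy by (simp add: A)
  have "B (x \<star> x) * B (y \<star> y) \<le> (A (x \<star> y))\<^sup>2"
    unfolding BB_A A[OF xy] by (rule four_mult_le_power2_sum)
  moreover have "(A (x \<star> y))\<^sup>2 \<le> A (x \<star> x) * A (y \<star> y)"
    unfolding AA A[OF xy] by (rule cauchy_schwarz_two_squares)
  moreover have "B (x \<star> x) * B (y \<star> y) \<le> (B (x \<star> y))\<^sup>2"
    unfolding BB_B B[OF xy] by (rule four_mult_le_power2_sum)
  moreover have "(B (x \<star> y))\<^sup>2 \<le> A (x \<star> x) * A (y \<star> y)"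
    using cauchy_schwarz_two_squares[of "f x" "g y" "g x" "f y"]
    unfolding AA B[OF xy] by (simp add: add.commute)
  ultimately show "(B (x \<star> x) * B (y \<star> y) \<le> (A (x \<star> y))\<^sup>2 \<and>
            (A (x \<star> y))\<^sup>2 \<le> A (x \<star> x) * A (y \<star> y)) \<and>
           (B (x \<star> x) * B (y \<star> y) \<le> (B (x \<star> y))\<^sup>2 \<and>
            (B (x \<star> y))\<^sup>2 \<le> A (x \<star> x) * A (y \<star> y))"
    by blast
qed

end
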